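(* Let $0<\tau\le T$ and let $W=(W_t)_{t\in[0,T]}$ be a real standard Brownian motion. The $C([-\tau,0])$-valued window Brownian motion $W(\cdot)$ is not a Pettis semimartingale.
   Context: Fix $T>0$ and a probability space $(\Omega,\mathcal F,\mathbb P)$. Processes on $[0,T]$ are extended by $W_t=W_0$ for $t\le0$ and $W_t=W_T$ for $t\ge T$. The window process of $W$ is the $C([-\tau,0])$-valued process $W(\cdot)=(W_t(\cdot))_{t\in[0,T]}$ with $W_t(x)=W_{t+x}$, $x\in[-\tau,0]$. For a Banach space $B$, a $B$-valued process $\mathbb X$ is a Pettis semimartingale if for every $\phi\in B^*$ the process $(\langle\phi,\mathbb X_t\rangle)_{t\in[0,T]}$ is a real semimartingale (with respect to some filtration). The dual of $C([-\tau,0])$ is the space of finite signed Borel measures on $[-\tau,0]$. *)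

theory Defs
  imports "HOL-Probability.Probability"
begin

section \<open>Real semimartingales on a compact time interval\<close>

text \<open>
  Time runs through \<open>[0,T]\<close>. Processes are functions \<open>real \<Rightarrow> 'a \<Rightarrow> real\<close> (time first) of which only
  the values at times in \<open>[0,T]\<close> matter. Filtrations are those of \<open>HOL-Probability\<close>, indexed by the
  whole real line; a filtration on \<open>[0,T]\<close> becomes one of these by constant extension. The usual
  conditions are not required.
\<close>

definition filtration_on :: "'a measure \<Rightarrow> (real \<Rightarrow> 'a measure) \<Rightarrow> bool" where
  "filtration_on P F \<longleftrightarrow> filtration (space P) F \<and> (\<forall>t. subalgebra P (F t))"

definition adapted :: "(real \<Rightarrow> 'a measure) \<Rightarrow> real \<Rightarrow> (real \<Rightarrow> 'a \<Rightarrow> real) \<Rightarrow> bool" where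
  "adapted F T X \<longleftrightarrow> (\<forall>t\<in>{0..T}. X t \<in> borel_measurable (F t))"

definition martingale ::
    "'a measure \<Rightarrow> (real \<Rightarrow> 'a measure) \<Rightarrow> real \<Rightarrow> (real \<Rightarrow> 'a \<Rightarrow> real) \<Rightarrow> bool" where
  "martingale P F T N \<longleftrightarrow> adapted F T N \<and> (\<forall>t\<in>{0..T}. integrable P (N t)) \<and>
     (\<forall>s\<in>{0..T}. \<forall>t\<in>{s..T}. AE \<omega> in P. real_cond_exp P (F s) (N t) \<omega> = N s \<omega>)"

definition cadlag :: "real \<Rightarrow> (real \<Rightarrow> real) \<Rightarrow> bool" where
  "cadlag T f \<longleftrightarrow> (\<forall>t\<in>{0..<T}. (f \<longlongrightarrow> f t) (at_right t)) \<and>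
     (\<forall>t\<in>{0<..T}. \<exists>l. (f \<longlongrightarrow> l) (at_left t))"

definition bounded_variation :: "real \<Rightarrow> (real \<Rightarrow> real) \<Rightarrow> bool" where
  "bounded_variation T f \<longleftrightarrow> (\<exists>K. \<forall>n (s :: nat \<Rightarrow> real).
     mono_on {..n} s \<longrightarrow> s ` {..n} \<subseteq> {0..T} \<longrightarrow> (\<Sum>i<n. \<bar>f (s (Suc i)) - f (s i)\<bar>) \<le> K)"

text \<open>
  Stopping times take values in \<open>[0,\<infinity>)\<close>, any value above \<open>T\<close> playing the role of \<open>\<infinity>\<close>. On the closed
  interval \<open>[0,T]\<close> a localizing sequence almost surely reaches \<open>T\<close> after finitely many steps.
  Subtracting \<open>N 0\<close> avoids any integrability requirement on the initial value.
\<close>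

definition local_martingale ::
    "'a measure \<Rightarrow> (real \<Rightarrow> 'a measure) \<Rightarrow> real \<Rightarrow> (real \<Rightarrow> 'a \<Rightarrow> real) \<Rightarrow> bool" where
  "local_martingale P F T N \<longleftrightarrow> adapted F T N \<and> (AE \<omega> in P. cadlag T (\<lambda>t. N t \<omega>)) \<and>
     (\<exists>\<sigma> :: nat \<Rightarrow> 'a \<Rightarrow> real.
        (\<forall>n. stopping_time F (\<sigma> n) \<and> (\<forall>\<omega>\<in>space P. 0 \<le> \<sigma> n \<omega>)) \<and>
        (AE \<omega> in P. incseq (\<lambda>n. \<sigma> n \<omega>)) \<and>
        (AE \<omega> in P. \<exists>n. T \<le> \<sigma> n \<omega>) \<and>
        (\<forall>n. martingale P F T (\<lambda>t \<omega>. N (min t (\<sigma> n \<omega>)) \<omega> - N 0 \<omega>)))"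

definition finite_variation_process ::
    "'a measure \<Rightarrow> (real \<Rightarrow> 'a measure) \<Rightarrow> real \<Rightarrow> (real \<Rightarrow> 'a \<Rightarrow> real) \<Rightarrow> bool" where
  "finite_variation_process P F T A \<longleftrightarrow> adapted F T A \<and>
     (AE \<omega> in P. cadlag T (\<lambda>t. A t \<omega>) \<and> bounded_variation T (\<lambda>t. A t \<omega>))"

definition semimartingale ::
    "'a measure \<Rightarrow> (real \<Rightarrow> 'a measure) \<Rightarrow> real \<Rightarrow> (real \<Rightarrow> 'a \<Rightarrow> real) \<Rightarrow> bool" where
  "semimartingale P F T X \<longleftrightarrow> adapted F T X \<and>
     (\<exists>N A. local_martingale P F T N \<and> finite_variation_process P F T A \<and>
        (AE \<omega> in P. \<forall>t\<in>{0..T}. X t \<omega> = N t \<omega> + A t \<omega>))"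


section \<open>Pettis semimartingales\<close>

text \<open>
  The Banach space is a closed linear subspace \<open>B\<close> of a Banach space type (\<open>UNIV\<close> being allowed),
  so that spaces depending on a parameter, such as \<open>C([a,b])\<close>, are covered. Its dual consists of the
  bounded linear functionals on \<open>B\<close>, whose values outside \<open>B\<close> are irrelevant.
\<close>

definition dual_space :: "'b::real_normed_vector set \<Rightarrow> ('b \<Rightarrow> real) set" where
  "dual_space B = {\<phi>. (\<forall>x\<in>B. \<forall>y\<in>B. \<phi> (x + y) = \<phi> x + \<phi> y) \<and>
     (\<forall>c. \<forall>x\<in>B. \<phi> (c *\<^sub>R x) = c * \<phi> x) \<and> (\<exists>K. \<forall>x\<in>B. \<bar>\<phi> x\<bar> \<le> K * norm x)}"

text \<open>
  The filtration is allowed to depend on the functional, which gives the weakest notion of Pettis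
  semimartingale.
\<close>

definition pettis_semimartingale ::
    "'a measure \<Rightarrow> real \<Rightarrow> 'b::banach set \<Rightarrow> (real \<Rightarrow> 'a \<Rightarrow> 'b) \<Rightarrow> bool" where
  "pettis_semimartingale P T B X \<longleftrightarrow>
     (\<forall>\<phi>\<in>dual_space B. \<exists>F. filtration_on P F \<and> semimartingale P F T (\<lambda>t \<omega>. \<phi> (X t \<omega>)))"


section \<open>The space of continuous functions on a compact interval\<close>

text \<open>
  \<open>C([a,b])\<close> is identified with the bounded continuous functions on the real line that are constant
  on \<open>(-\<infinity>,a]\<close> and on \<open>[b,\<infinity>)\<close>. The lemmas below show that restriction to \<open>[a,b]\<close> is a bijection onto
  the continuous functions on \<open>[a,b]\<close>, isometric for the supremum norm, and that the space is a
  closed linear subspace.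
\<close>

instance bcontfun :: (metric_space, banach) banach ..

definition C_space :: "real \<Rightarrow> real \<Rightarrow> (real \<Rightarrow>\<^sub>C real) set" where
  "C_space a b = {f. ext_cont (apply_bcontfun f) a b = apply_bcontfun f}"

lemma clamp_real_in: "a \<le> b \<Longrightarrow> clamp a b (x::real) \<in> {a..b}"
  using clamp_in_interval[of a b x] by simp

lemma clamp_real_id: "(x::real) \<in> {a..b} \<Longrightarrow> clamp a b x = x"
  using clamp_cancel_cbox[of x a b] by simp

lemma C_space_iff: "f \<in> C_space a b \<longleftrightarrow> (\<forall>x. apply_bcontfun f (clamp a b x) = apply_bcontfun f x)"
  by (simp add: C_space_def ext_cont_def fun_eq_iff)

lemma ext_cont_bcontfun:
  fixes g :: "real \<Rightarrow> real"
  assumes "a \<le> b" "continuous_on {a..b} g"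
  shows "ext_cont g a b \<in> bcontfun"
proof -
  have "range (ext_cont g a b) \<subseteq> g ` {a..b}"
    using clamp_real_in[OF assms(1)] by (auto simp: ext_cont_def)
  moreover have "bounded (g ` {a..b})"
    using assms(2) by (intro compact_imp_bounded compact_continuous_image) auto
  ultimately have "bounded (range (ext_cont g a b))"
    by (rule bounded_subset[rotated])
  moreover have "continuous_on UNIV (ext_cont g a b)"
    using assms(2) by (intro continuous_on_ext_cont) simp
  ultimately show ?thesis
    by (simp add: bcontfun_def)
qed

lemma
  assumes "a \<le> b" "continuous_on {a..b} g"
  shows apply_Bcontfun_ext_cont: "apply_bcontfun (Bcontfun (ext_cont g a b)) = ext_cont g a b"
    and Bcontfun_ext_cont_in_C_space: "Bcontfun (ext_cont g a b) \<in> C_space a b"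
proof -
  show *: "apply_bcontfun (Bcontfun (ext_cont g a b)) = ext_cont g a b"
    using ext_cont_bcontfun[OF assms] by (rule Bcontfun_inverse)
  show "Bcontfun (ext_cont g a b) \<in> C_space a b"
    using clamp_real_in[OF assms(1)]
    unfolding C_space_iff * by (simp add: ext_cont_def clamp_real_id)
qed

lemma C_space_restriction_bij:
  assumes "a \<le> b" "continuous_on {a..b} g"
  shows "\<exists>!f. f \<in> C_space a b \<and> (\<forall>x\<in>{a..b}. apply_bcontfun f x = g x)"
proof (rule ex1I[of _ "Bcontfun (ext_cont g a b)"])
  show "Bcontfun (ext_cont g a b) \<in> C_space a b \<and>
      (\<forall>x\<in>{a..b}. apply_bcontfun (Bcontfun (ext_cont g a b)) x = g x)"
    using Bcontfun_ext_cont_in_C_space[OF assms] unfolding apply_Bcontfun_ext_cont[OF assms]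
    by (simp add: ext_cont_def clamp_real_id)
next
  fix f assume f: "f \<in> C_space a b \<and> (\<forall>x\<in>{a..b}. apply_bcontfun f x = g x)"
  show "f = Bcontfun (ext_cont g a b)"
  proof (rule bcontfun_eqI)
    fix x
    have "apply_bcontfun f x = apply_bcontfun f (clamp a b x)"
      using f by (simp add: C_space_iff)
    also have "\<dots> = g (clamp a b x)"
      using f clamp_real_in[OF assms(1)] by blast
    finally show "apply_bcontfun f x = apply_bcontfun (Bcontfun (ext_cont g a b)) x"
      unfolding apply_Bcontfun_ext_cont[OF assms] by (simp add: ext_cont_def)
  qed
qed

lemma norm_C_space:
  assumes "a \<le> b" "f \<in> C_space a b"
  shows "norm f = (SUP x\<in>{a..b}. \<bar>apply_bcontfun f x\<bar>)"
proof -
  have "range (\<lambda>x. \<bar>apply_bcontfun f x\<bar>) = (\<lambda>x. \<bar>apply_bcontfun f x\<bar>) ` {a..b}"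
  proof
    show "range (\<lambda>x. \<bar>apply_bcontfun f x\<bar>) \<subseteq> (\<lambda>x. \<bar>apply_bcontfun f x\<bar>) ` {a..b}"
    proof
      fix y assume "y \<in> range (\<lambda>x. \<bar>apply_bcontfun f x\<bar>)"
      then obtain x where "y = \<bar>apply_bcontfun f x\<bar>" by blast
      then have "y = \<bar>apply_bcontfun f (clamp a b x)\<bar>"
        using assms(2) by (simp add: C_space_iff)
      then show "y \<in> (\<lambda>x. \<bar>apply_bcontfun f x\<bar>) ` {a..b}"
        using clamp_real_in[OF assms(1)] by blast
    qed
  qed blast
  then show ?thesis
    by (simp add: norm_bcontfun_def dist_bcontfun.rep_eq zero_bcontfun.rep_eq dist_real_def)
qed

lemma subspace_C_space: "subspace (C_space a b)"
  by (auto simp: subspace_def C_space_iff zero_bcontfun.rep_eq plus_bcontfun.rep_eq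
      scaleR_bcontfun.rep_eq)

lemma closed_C_space: "closed (C_space a b)"
proof -
  have lim: "(\<lambda>n. apply_bcontfun (X n) x) \<longlonglongrightarrow> apply_bcontfun l x"
    if "X \<longlonglongrightarrow> l" for X :: "nat \<Rightarrow> real \<Rightarrow>\<^sub>C real" and l x
    using tendsto_bcontfun_uniform_limit[OF that] by (rule tendsto_uniform_limitI) simp
  show ?thesis
    unfolding closed_sequential_limits
  proof (intro allI impI)
    fix X :: "nat \<Rightarrow> real \<Rightarrow>\<^sub>C real" and l
    assume A: "(\<forall>n. X n \<in> C_space a b) \<and> X \<longlonglongrightarrow> l"
    then have eq: "apply_bcontfun (X n) (clamp a b x) = apply_bcontfun (X n) x" for n x
      by (simp add: C_space_iff)
    have "apply_bcontfun l (clamp a b x) = apply_bcontfun l x" for x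
    proof (rule LIMSEQ_unique)
      show "(\<lambda>n. apply_bcontfun (X n) x) \<longlonglongrightarrow> apply_bcontfun l (clamp a b x)"
        using lim[of X l "clamp a b x"] A by (simp add: eq)
      show "(\<lambda>n. apply_bcontfun (X n) x) \<longlonglongrightarrow> apply_bcontfun l x"
        using lim A by blast
    qed
    then show "l \<in> C_space a b"
      by (simp add: C_space_iff)
  qed
qed


section \<open>Window Brownian motion\<close>

text \<open>
  All paths are continuous, so that the window takes its values in \<open>C([-\<tau>,0])\<close>;
  \<open>normal_density\<close> is parametrized by the standard deviation.
\<close>

definition standard_brownian_motion ::
    "'a measure \<Rightarrow> real \<Rightarrow> (real \<Rightarrow> 'a \<Rightarrow> real) \<Rightarrow> bool" where
  "standard_brownian_motion P T W \<longleftrightarrow>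
     (\<forall>t\<in>{0..T}. W t \<in> borel_measurable P) \<and>
     (AE \<omega> in P. W 0 \<omega> = 0) \<and>
     (\<forall>\<omega>\<in>space P. continuous_on {0..T} (\<lambda>t. W t \<omega>)) \<and>
     (\<forall>s\<in>{0..T}. \<forall>t\<in>{s<..T}.
        distributed P lborel (\<lambda>\<omega>. W t \<omega> - W s \<omega>) (normal_density 0 (sqrt (t - s)))) \<and>
     (\<forall>n (s :: nat \<Rightarrow> real). mono_on {..n} s \<longrightarrow> s ` {..n} \<subseteq> {0..T} \<longrightarrow>
        prob_space.indep_vars P (\<lambda>_. borel) (\<lambda>i \<omega>. W (s (Suc i)) \<omega> - W (s i) \<omega>) {..<n})"

text \<open>\<open>W\<^sub>t = W\<^sub>0\<close> for \<open>t \<le> 0\<close> and \<open>W\<^sub>t = W\<^sub>T\<close> for \<open>t \<ge> T\<close>.\<close>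

definition extended_process :: "real \<Rightarrow> (real \<Rightarrow> 'a \<Rightarrow> real) \<Rightarrow> real \<Rightarrow> 'a \<Rightarrow> real" where
  "extended_process T W t \<omega> = (if t \<le> 0 then W 0 \<omega> else if t \<ge> T then W T \<omega> else W t \<omega>)"

definition window_process ::
    "real \<Rightarrow> real \<Rightarrow> (real \<Rightarrow> 'a \<Rightarrow> real) \<Rightarrow> real \<Rightarrow> 'a \<Rightarrow> (real \<Rightarrow>\<^sub>C real)" where
  "window_process T \<tau> W t \<omega> = Bcontfun (ext_cont (\<lambda>x. extended_process T W (t + x) \<omega>) (-\<tau>) 0)"

lemma continuous_extended_process:
  assumes "0 < T" "continuous_on {0..T} (\<lambda>t. W t \<omega>)"
  shows "continuous_on S (\<lambda>t. extended_process T W t \<omega>)"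
proof -
  have eq: "extended_process T W t \<omega> = W (max 0 (min t T)) \<omega>" for t
    using assms(1) by (auto simp: extended_process_def max_def min_def)
  have "continuous_on S (\<lambda>t. W (max 0 (min t T)) \<omega>)"
    by (rule continuous_on_compose2[OF assms(2)]) (use assms(1) in \<open>auto intro!: continuous_intros\<close>)
  then show ?thesis unfolding eq .
qed

lemma
  assumes "0 < T" "0 < \<tau>" "continuous_on {0..T} (\<lambda>t. W t \<omega>)"
  shows window_process_in_C_space: "window_process T \<tau> W t \<omega> \<in> C_space (-\<tau>) 0"
    and window_process_apply:
      "x \<in> {-\<tau>..0} \<Longrightarrow> apply_bcontfun (window_process T \<tau> W t \<omega>) x = extended_process T W (t + x) \<omega>"
proof -
  have c: "continuous_on {-\<tau>..0} (\<lambda>x. extended_process T W (t + x) \<omega>)"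
    by (rule continuous_on_compose2[OF continuous_extended_process[where S = UNIV and T = T]])
      (use assms in \<open>auto intro!: continuous_intros\<close>)
  have le: "-\<tau> \<le> 0" using assms(2) by simp
  show "window_process T \<tau> W t \<omega> \<in> C_space (-\<tau>) 0"
    unfolding window_process_def by (rule Bcontfun_ext_cont_in_C_space[OF le c])
  show "apply_bcontfun (window_process T \<tau> W t \<omega>) x = extended_process T W (t + x) \<omega>"
    if "x \<in> {-\<tau>..0}"
    unfolding window_process_def apply_Bcontfun_ext_cont[OF le c]
    by (simp only: ext_cont_def clamp_real_id[OF that])
qed

end

theory Submission
  imports Defs "HOL-Real_Asymp.Real_Asymp"
begin

text \<open>
  A semimartingale cannot let a trader win without bound while risking only a bounded loss. A
  window, in contrast, remembers the path. Hence a functional that makes a piece of the Brownian path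
  known first and then replays this piece with a delay violates the semimartingale property: a
  trader who knows the path in advance bets on the sign of each increment and collects the total
  variation, which is infinite.

  The functional is \<open>\<phi>(f) = f (-a) + \<integral>\<^bsub>[-a,0]\<^esub> f\<close> with \<open>a = \<tau> / 2\<close>. Applied to the window it gives
  \<open>X\<^sub>t = W (t - a) + \<integral>\<^bsub>[t-a,t]\<^esub> W\<close>. For \<open>t \<le> a\<close> the first term is constant, and differentiating the
  integral from the left recovers \<open>W t - W 0\<close> from \<open>X\<close> up to time \<open>t\<close>
  (\<open>delay_functional_difference_quotient_tendsto\<close>). So \<open>W u - W 0\<close> is known at time \<open>u \<le> a\<close> in every
  filtration to which \<open>X\<close> is adapted, however large it is; in particular \<open>W\<close> need not be a Brownian
  motion for that filtration. For \<open>t \<in> [a, 2 * a]\<close> the integral is Lipschitz in \<open>t\<close>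
  (\<open>delay_functional_minus_delay_lipschitz\<close>), and so \<open>X\<close> is the delayed path up to a process of finite
  variation.

  That bets on the increments in \<open>[a, 2 * a]\<close> contradict a decomposition \<open>X = N + A\<close> is shown in
  \<open>semimartingale_not_anticipated_delayed_brownian\<close>. It combines two facts: the
  variation of \<open>W\<close> along equidistant grids tends to infinity in probability
  (\<open>brownian_variation_unbounded\<close>), and, on an event where the gains of a bounded strategy in a martingale
  stay above a fixed level and the martingale itself stays bounded, the final gain can exceed \<open>R\<close>
  only with probability of order \<open>1 / R\<close>, uniformly in the grid (\<open>martingale_gains_bound\<close>). The latter is an optional stopping
  argument; it needs only integrability of the martingale, since the loss in the last step before
  stopping is controlled by the martingale itself at that time.
\<close>


section \<open>Gains from trading in a martingale\<close>

lemma filtration_on_borel_measurable_mono: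
  fixes f :: "'a \<Rightarrow> real"
  assumes "filtration_on P F" "s \<le> t" "f \<in> borel_measurable (F s)"
  shows "f \<in> borel_measurable (F t)"
proof -
  interpret filtration "space P" F
    using assms(1) by (simp add: filtration_on_def)
  show ?thesis
    using assms(3) sets_F_mono[OF assms(2)] space_F[of s] space_F[of t]
    by (auto simp: measurable_def)
qed

lemma filtration_on_borel_measurable:
  fixes f :: "'a \<Rightarrow> real"
  assumes "filtration_on P F" "f \<in> borel_measurable (F s)"
  shows "f \<in> borel_measurable P"
  using assms measurable_from_subalg[of P "F s"] by (auto simp: filtration_on_def)

lemma integrable_bounded_mult:
  fixes f g :: "'a \<Rightarrow> real"
  assumes "integrable P g" "f \<in> borel_measurable P" "\<And>\<omega>. \<bar>f \<omega>\<bar> \<le> 1"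
  shows "integrable P (\<lambda>\<omega>. f \<omega> * g \<omega>)"
proof (rule Bochner_Integration.integrable_bound[OF assms(1)])
  show "(\<lambda>\<omega>. f \<omega> * g \<omega>) \<in> borel_measurable P"
    using assms(1,2) by measurable
  show "AE \<omega> in P. norm (f \<omega> * g \<omega>) \<le> norm (g \<omega>)"
    using mult_right_mono[OF assms(3) abs_ge_zero] by (auto simp: abs_mult)
qed

lemma martingale_integral_mult:
  assumes "prob_space P" "filtration_on P F" "martingale P F T M"
    and st: "0 \<le> s" "s \<le> t" "t \<le> T"
    and f: "f \<in> borel_measurable (F s)" "\<And>\<omega>. \<bar>f \<omega>\<bar> \<le> 1"
  shows "(\<integral>\<omega>. f \<omega> * M t \<omega> \<partial>P) = (\<integral>\<omega>. f \<omega> * M s \<omega> \<partial>P)"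
proof -
  interpret prob_space P by fact
  interpret finite_measure_subalgebra P "F s"
    using assms(2) by unfold_locales (simp add: filtration_on_def)
  have M: "integrable P (M t)" "integrable P (M s)"
    and c: "AE \<omega> in P. real_cond_exp P (F s) (M t) \<omega> = M s \<omega>"
    using assms(3) st by (auto simp: martingale_def)
  have fP: "f \<in> borel_measurable P"
    using filtration_on_borel_measurable[OF assms(2) f(1)] .
  have "(\<integral>\<omega>. f \<omega> * M t \<omega> \<partial>P) = (\<integral>\<omega>. f \<omega> * real_cond_exp P (F s) (M t) \<omega> \<partial>P)"
    using M by (intro real_cond_exp_intg(2)[symmetric] integrable_bounded_mult f fP) auto
  also have "\<dots> = (\<integral>\<omega>. f \<omega> * M s \<omega> \<partial>P)"
    using c M fP by (intro integral_cong_AE) auto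
  finally show ?thesis .
qed

text \<open>
  The absolute value of a martingale is a submartingale, tested against a weight \<open>f\<close> known at
  time \<open>s\<close>: multiplying by the sign of \<open>M s\<close> turns \<open>\<bar>M s\<bar>\<close> into \<open>M s\<close>, and the sign is known at time
  \<open>s\<close> as well.
\<close>

lemma martingale_integral_indicator_abs_le:
  assumes "prob_space P" "filtration_on P F" "martingale P F T M"
    and st: "0 \<le> s" "s \<le> t" "t \<le> T"
    and f: "f \<in> borel_measurable (F s)" "\<And>\<omega>. 0 \<le> f \<omega>" "\<And>\<omega>. f \<omega> \<le> 1"
  shows "(\<integral>\<omega>. f \<omega> * \<bar>M s \<omega>\<bar> \<partial>P) \<le> (\<integral>\<omega>. f \<omega> * \<bar>M t \<omega>\<bar> \<partial>P)"
proof -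
  have M: "integrable P (M t)" "integrable P (M s)" and Ms: "M s \<in> borel_measurable (F s)"
    using assms(3) st by (auto simp: martingale_def adapted_def)
  let ?g = "\<lambda>\<omega>. f \<omega> * sgn (M s \<omega>)"
  have g: "?g \<in> borel_measurable (F s)"
    using f(1) Ms by measurable
  have g1: "\<bar>?g \<omega>\<bar> \<le> 1" for \<omega>
    using f(2,3) by (simp add: abs_mult abs_sgn_eq)
  note fP = filtration_on_borel_measurable[OF assms(2) f(1)]
    and gP = filtration_on_borel_measurable[OF assms(2) g]
  have "(\<integral>\<omega>. f \<omega> * \<bar>M s \<omega>\<bar> \<partial>P) = (\<integral>\<omega>. ?g \<omega> * M s \<omega> \<partial>P)"
    by (intro arg_cong[where f = "integral\<^sup>L P"] ext) (auto simp: sgn_if)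
  also have "\<dots> = (\<integral>\<omega>. ?g \<omega> * M t \<omega> \<partial>P)"
    using martingale_integral_mult[OF assms(1-3) st g g1] by simp
  also have "\<dots> \<le> (\<integral>\<omega>. f \<omega> * \<bar>M t \<omega>\<bar> \<partial>P)"
  proof (rule integral_mono)
    show "integrable P (\<lambda>\<omega>. ?g \<omega> * M t \<omega>)"
      using M gP g1 by (intro integrable_bounded_mult)
    show "integrable P (\<lambda>\<omega>. f \<omega> * \<bar>M t \<omega>\<bar>)"
      using M fP f by (intro integrable_bounded_mult) auto
    show "?g \<omega> * M t \<omega> \<le> f \<omega> * \<bar>M t \<omega>\<bar>" for \<omega>
      using f(2)[of \<omega>] mult_left_mono[of "M t \<omega>" "\<bar>M t \<omega>\<bar>" "f \<omega>"]
         mult_left_mono[of "-M t \<omega>" "\<bar>M t \<omega>\<bar>" "f \<omega>"] by (auto simp: sgn_if)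
  qed
  finally show ?thesis .
qed

text \<open>
  The pathwise half of the next lemma. Here \<open>g\<close> is the cumulative gain of the strategy \<open>h\<close> in the
  price sequence \<open>m\<close>, and trading stops at the first index at which \<open>ok\<close> fails. One step before,
  the gain was at least \<open>- C\<close> and the price at most \<open>K\<close> in absolute value, so the stopping index
  \<open>j\<close> can cost no more than \<open>C + K + \<bar>m j\<bar>\<close>. The second sum has at most one nonzero term, which is
  this \<open>\<bar>m j\<bar>\<close>.
\<close>

lemma stopped_gains_lower_bound:
  fixes h m :: "nat \<Rightarrow> real" and C K :: real
  defines "g \<equiv> \<lambda>k. \<Sum>i<k. h i * (m (Suc i) - m i)"
  defines "ok \<equiv> \<lambda>j. - C \<le> g j \<and> \<bar>m j\<bar> \<le> K"
  assumes h: "\<And>i. i < n \<Longrightarrow> \<bar>h i\<bar> \<le> 1" and "0 \<le> C" "0 \<le> K" "k \<le> n"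
  shows "(\<forall>j<k. ok j) \<Longrightarrow> (\<Sum>i<k. of_bool (\<forall>j\<le>i. ok j) * (h i * (m (Suc i) - m i))) = g k"
    and "- (C + K) \<le> (\<Sum>i<k. of_bool (\<forall>j\<le>i. ok j) * (h i * (m (Suc i) - m i)))
           + (\<Sum>j\<le>k. of_bool ((\<forall>i<j. ok i) \<and> \<not> ok j) * \<bar>m j\<bar>)"
proof -
  have eq: "(\<Sum>i<k. of_bool (\<forall>j\<le>i. ok j) * (h i * (m (Suc i) - m i))) = g k"
    if "\<forall>j<k. ok j" for k
    unfolding g_def using that by (intro sum.cong) auto
  then show "(\<forall>j<k. ok j) \<Longrightarrow> (\<Sum>i<k. of_bool (\<forall>j\<le>i. ok j) * (h i * (m (Suc i) - m i))) = g k" .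
  show "- (C + K) \<le> (\<Sum>i<k. of_bool (\<forall>j\<le>i. ok j) * (h i * (m (Suc i) - m i)))
      + (\<Sum>j\<le>k. of_bool ((\<forall>i<j. ok i) \<and> \<not> ok j) * \<bar>m j\<bar>)"
    using \<open>k \<le> n\<close>
  proof (induction k)
    case 0
    show ?case
      using assms(4,5) by (intro order_trans[OF _ add_nonneg_nonneg] sum_nonneg) auto
  next
    case (Suc k)
    show ?case
    proof (cases "\<forall>j\<le>k. ok j")
      case True
      let ?e = "of_bool ((\<forall>i<Suc k. ok i) \<and> \<not> ok (Suc k)) * \<bar>m (Suc k)\<bar> :: real"
      have s: "?e \<le> (\<Sum>j\<le>Suc k. of_bool ((\<forall>i<j. ok i) \<and> \<not> ok j) * \<bar>m j\<bar>)"
        by (simp add: sum_nonneg)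
      have "- (C + K) \<le> g (Suc k) + ?e"
      proof (cases "ok (Suc k)")
        case True
        then show ?thesis using assms(4,5) by (simp add: ok_def)
      next
        case False
        have "\<bar>h k * (m (Suc k) - m k)\<bar> \<le> \<bar>m (Suc k) - m k\<bar>"
          using mult_right_mono[OF h[of k] abs_ge_zero] Suc.prems by (simp add: abs_mult)
        moreover have "- C \<le> g k" "\<bar>m k\<bar> \<le> K" using True by (auto simp: ok_def)
        moreover have "g (Suc k) = g k + h k * (m (Suc k) - m k)" by (simp add: g_def)
        moreover have "?e = \<bar>m (Suc k)\<bar>" using True False by (auto simp: less_Suc_eq_le)
        ultimately show ?thesis by linarith
      qed
      moreover have "(\<Sum>i<Suc k. of_bool (\<forall>j\<le>i. ok j) * (h i * (m (Suc i) - m i))) = g (Suc k)"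
        using True by (intro eq) (auto simp: less_Suc_eq_le)
      ultimately show ?thesis using s by linarith
    next
      case False
      then have "of_bool (\<forall>j\<le>k. ok j) = (0::real)"
        and "of_bool ((\<forall>i<Suc k. ok i) \<and> \<not> ok (Suc k)) = (0::real)"
        by (auto simp: less_Suc_eq_le)
      then show ?thesis
        using Suc.IH[OF Suc_leD[OF Suc.prems]]
        by (simp only: sum.lessThan_Suc sum.atMost_Suc mult_zero_left add_0_right)
    qed
  qed
qed

text \<open>
  Bounded trading in a martingale cannot win much while never losing much. Stop at the first grid
  time at which the gain falls below \<open>- C\<close> or \<open>\<bar>M\<bar>\<close> exceeds \<open>K\<close>. The stopped gain has expectation
  \<open>0\<close>; it is bounded below by \<open>- (C + K)\<close> minus the value of \<open>\<bar>M\<bar>\<close> at the stopping time, whose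
  expectation is at most that of \<open>\<bar>M\<bar>\<close> at the last grid time; and it is at least \<open>R\<close> on \<open>B\<close>. The
  point of the bound is that it does not involve the number of grid points.
\<close>

lemma martingale_gains_bound:
  fixes t :: "nat \<Rightarrow> real" and H :: "nat \<Rightarrow> 'a \<Rightarrow> real" and C K R :: real
  defines "G \<equiv> \<lambda>M k \<omega>. \<Sum>i<k. H i \<omega> * (M (t (Suc i)) \<omega> - M (t i) \<omega>)"
  assumes "prob_space P" "filtration_on P F" "martingale P F T M"
    and t: "mono t" "0 \<le> t 0" "t n \<le> T"
    and H: "\<And>i. i < n \<Longrightarrow> H i \<in> borel_measurable (F (t i))" "\<And>i \<omega>. \<bar>H i \<omega>\<bar> \<le> 1"
    and C: "0 \<le> C" "0 \<le> K" "0 \<le> R"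
    and B: "B \<in> sets P" "\<And>\<omega> k. \<omega> \<in> B \<Longrightarrow> k \<le> n \<Longrightarrow> - C \<le> G M k \<omega> \<and> \<bar>M (t k) \<omega>\<bar> \<le> K"
      "\<And>\<omega>. \<omega> \<in> B \<Longrightarrow> R \<le> G M n \<omega>"
  shows "R * measure P B \<le> C + K + (\<integral>\<omega>. \<bar>M (t n) \<omega>\<bar> \<partial>P)"
proof -
  interpret prob_space P by fact
  define ok where "ok j \<omega> \<longleftrightarrow> - C \<le> G M j \<omega> \<and> \<bar>M (t j) \<omega>\<bar> \<le> K" for j \<omega>
  define D :: "nat \<Rightarrow> 'a \<Rightarrow> real" where "D i \<omega> = of_bool (\<forall>j\<le>i. ok j \<omega>)" for i \<omega>
  define E :: "nat \<Rightarrow> 'a \<Rightarrow> real" where "E j \<omega> = of_bool ((\<forall>i<j. ok i \<omega>) \<and> \<not> ok j \<omega>)" for j \<omega>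
  define V where "V \<omega> = (\<Sum>i<n. D i \<omega> * (H i \<omega> * (M (t (Suc i)) \<omega> - M (t i) \<omega>)))" for \<omega>
  have tn: "0 \<le> t i \<and> t i \<le> T" if "i \<le> n" for i
    using monoD[OF t(1), of 0 i] monoD[OF t(1) that] t(2,3) by simp
  have tm: "t i \<le> t j" if "i \<le> j" for i j
    using monoD[OF t(1) that] .
  have M: "M (t i) \<in> borel_measurable (F (t i))" "integrable P (M (t i))" if "i \<le> n" for i
    using assms(4) tn[OF that] by (auto simp: martingale_def adapted_def)
  have M': "M (t i) \<in> borel_measurable (F (t j))" if "i \<le> j" "j \<le> n" for i j
    using filtration_on_borel_measurable_mono[OF assms(3) tm[OF that(1)] M(1)] that by simp
  have H': "H i \<in> borel_measurable (F (t j))" if "i \<le> j" "i < n" for i j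
    using filtration_on_borel_measurable_mono[OF assms(3) tm[OF that(1)] H(1)] that by simp
  have G: "G M k \<in> borel_measurable (F (t j))" if "k \<le> j" "j \<le> n" for k j
    unfolding G_def using that
    by (intro borel_measurable_sum borel_measurable_times borel_measurable_diff H' M') auto
  have ok: "Measurable.pred (F (t j)) (ok k)" if "k \<le> j" "j \<le> n" for k j
    unfolding ok_def[abs_def] using G[OF that] M'[OF that] by measurable
  have D: "D i \<in> borel_measurable (F (t i))" if "i \<le> n" for i
  proof -
    have "Measurable.pred (F (t i)) (\<lambda>\<omega>. \<forall>j\<in>{..i}. ok j \<omega>)"
      by (intro pred_intros_finite ok) (use that in auto)
    then have *: "{\<omega>\<in>space (F (t i)). \<forall>j\<le>i. ok j \<omega>} \<in> sets (F (t i))"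
      by (simp only: pred_def Ball_def atMost_iff)
    show ?thesis
      unfolding D_def[abs_def] of_bool_def 
      by (rule measurable_If[OF borel_measurable_const borel_measurable_const *])
  qed
  have E: "E i \<in> borel_measurable (F (t i))" if "i \<le> n" for i
  proof -
    have "Measurable.pred (F (t i)) (\<lambda>\<omega>. (\<forall>j\<in>{..<i}. ok j \<omega>) \<and> \<not> ok i \<omega>)"
      by (intro pred_intros_logic pred_intros_finite ok) (use that in auto)
    then have *: "{\<omega>\<in>space (F (t i)). (\<forall>j<i. ok j \<omega>) \<and> \<not> ok i \<omega>} \<in> sets (F (t i))"
      by (simp only: pred_def Ball_def lessThan_iff)
    show ?thesis
      unfolding E_def[abs_def] of_bool_def 
      by (rule measurable_If[OF borel_measurable_const borel_measurable_const *])
  qed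
  note P = filtration_on_borel_measurable[OF assms(3)]
  have D1: "\<bar>D i \<omega> * H i \<omega>\<bar> \<le> 1" for i \<omega>
    using H(2)[of i \<omega>] by (simp add: D_def)
  have DH: "(\<lambda>\<omega>. D i \<omega> * H i \<omega>) \<in> borel_measurable (F (t i))" if "i < n" for i
    using that by (intro borel_measurable_times D H(1)) auto
  have intV: "integrable P (\<lambda>\<omega>. D i \<omega> * H i \<omega> * M (t j) \<omega>)" if "i < n" "j \<le> n" for i j
    using M(2)[OF that(2)] P[OF DH[OF that(1)]] D1 by (intro integrable_bounded_mult)
  have V_eq: "V = (\<lambda>\<omega>. \<Sum>i<n. D i \<omega> * H i \<omega> * M (t (Suc i)) \<omega> - D i \<omega> * H i \<omega> * M (t i) \<omega>)"
    unfolding V_def[abs_def] by (intro ext sum.cong) (auto simp: algebra_simps)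
  have V: "integrable P V" "(\<integral>\<omega>. V \<omega> \<partial>P) = 0"
  proof -
    show "integrable P V"
      unfolding V_eq using intV by (intro Bochner_Integration.integrable_sum
        Bochner_Integration.integrable_diff) auto
    have "(\<integral>\<omega>. V \<omega> \<partial>P) = (\<Sum>i<n. (\<integral>\<omega>. D i \<omega> * H i \<omega> * M (t (Suc i)) \<omega> \<partial>P)
        - (\<integral>\<omega>. D i \<omega> * H i \<omega> * M (t i) \<omega> \<partial>P))"
      unfolding V_eq using intV by (subst Bochner_Integration.integral_sum) auto
    also have "\<dots> = 0"
    proof (intro sum.neutral ballI)
      fix i assume "i \<in> {..<n}"
      then have i: "i < n" by simp
      have "(\<integral>\<omega>. D i \<omega> * H i \<omega> * M (t (Suc i)) \<omega> \<partial>P) = (\<integral>\<omega>. D i \<omega> * H i \<omega> * M (t i) \<omega> \<partial>P)"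
        by (rule martingale_integral_mult[OF assms(2-4) _ _ _ DH[OF i] D1])
          (use tn[of i] tn[of "Suc i"] tm[of i "Suc i"] i in auto)
      then show "(\<integral>\<omega>. D i \<omega> * H i \<omega> * M (t (Suc i)) \<omega> \<partial>P)
          - (\<integral>\<omega>. D i \<omega> * H i \<omega> * M (t i) \<omega> \<partial>P) = 0"
        by simp
    qed
    finally show "(\<integral>\<omega>. V \<omega> \<partial>P) = 0" .
  qed
  have E01: "0 \<le> E j \<omega>" "E j \<omega> \<le> 1" for j \<omega>
    by (auto simp: E_def)
  have intE: "integrable P (\<lambda>\<omega>. E j \<omega> * \<bar>M (t k) \<omega>\<bar>)" if "j \<le> n" "k \<le> n" for j k
    using M(2)[OF that(2)] P[OF E[OF that(1)]] E01 by (intro integrable_bounded_mult) auto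
  \<comment> \<open>At most one index is the first at which \<open>ok\<close> fails.\<close>
  have sumE: "(\<Sum>j\<le>n. E j \<omega>) \<le> 1" for \<omega>
  proof (cases "\<exists>j. \<not> ok j \<omega>")
    case True
    define j where "j = (LEAST j. \<not> ok j \<omega>)"
    have "E i \<omega> = of_bool (i = j)" for i
    proof -
      have "\<not> ok j \<omega>" and "i < j \<Longrightarrow> ok i \<omega>"
        using LeastI_ex[OF True] not_less_Least unfolding j_def by blast+
      moreover have "i < j \<or> i = j \<or> j < i" by linarith
      moreover have "\<forall>k<j. ok k \<omega>"
        using not_less_Least unfolding j_def by blast
      ultimately show ?thesis unfolding E_def by auto
    qed
    then show ?thesis by (simp add: of_bool_def)
  qed (simp add: E_def)
  have "(\<Sum>j\<le>n. \<integral>\<omega>. E j \<omega> * \<bar>M (t j) \<omega>\<bar> \<partial>P) \<le> (\<Sum>j\<le>n. \<integral>\<omega>. E j \<omega> * \<bar>M (t n) \<omega>\<bar> \<partial>P)"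
  proof (rule sum_mono)
    fix j assume "j \<in> {..n}"
    then have j: "j \<le> n" by simp
    show "(\<integral>\<omega>. E j \<omega> * \<bar>M (t j) \<omega>\<bar> \<partial>P) \<le> (\<integral>\<omega>. E j \<omega> * \<bar>M (t n) \<omega>\<bar> \<partial>P)"
      by (rule martingale_integral_indicator_abs_le[OF assms(2-4) _ _ _ E[OF j] E01])
        (use tn[of j] tn[of n] tm[OF j] j in auto)
  qed
  also have "\<dots> = (\<integral>\<omega>. (\<Sum>j\<le>n. E j \<omega>) * \<bar>M (t n) \<omega>\<bar> \<partial>P)"
    unfolding sum_distrib_right using intE by (subst Bochner_Integration.integral_sum) auto
  also have "\<dots> \<le> (\<integral>\<omega>. \<bar>M (t n) \<omega>\<bar> \<partial>P)"
  proof (rule integral_mono)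
    show "integrable P (\<lambda>\<omega>. (\<Sum>j\<le>n. E j \<omega>) * \<bar>M (t n) \<omega>\<bar>)"
      unfolding sum_distrib_right using intE by (intro Bochner_Integration.integrable_sum) auto
    show "(\<Sum>j\<le>n. E j \<omega>) * \<bar>M (t n) \<omega>\<bar> \<le> \<bar>M (t n) \<omega>\<bar>" for \<omega>
      using mult_right_mono[OF sumE[of \<omega>], of "\<bar>M (t n) \<omega>\<bar>"] by simp
  qed (use M(2)[of n] in simp)
  finally have S: "(\<Sum>j\<le>n. \<integral>\<omega>. E j \<omega> * \<bar>M (t j) \<omega>\<bar> \<partial>P) \<le> (\<integral>\<omega>. \<bar>M (t n) \<omega>\<bar> \<partial>P)" .
  \<comment> \<open>The stopped gain, raised by a variable that makes it nonnegative.\<close>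
  let ?U = "\<lambda>\<omega>. V \<omega> + (C + K) + (\<Sum>j\<le>n. E j \<omega> * \<bar>M (t j) \<omega>\<bar>)"
  have "R * measure P B = (\<integral>\<omega>. R * indicator B \<omega> \<partial>P)"
    using B(1) by (simp add: emeasure_eq_measure)
  also have "\<dots> \<le> (\<integral>\<omega>. ?U \<omega> \<partial>P)"
  proof (rule integral_mono)
    show "integrable P (\<lambda>\<omega>. R * indicator B \<omega>)"
      using B(1) by (simp add: emeasure_eq_measure)
    show "integrable P ?U"
      using V(1) intE
      by (intro Bochner_Integration.integrable_add Bochner_Integration.integrable_sum) auto
    fix \<omega>
    have lb: "- (C + K) \<le> V \<omega> + (\<Sum>j\<le>n. E j \<omega> * \<bar>M (t j) \<omega>\<bar>)"
      unfolding V_def D_def E_def ok_def G_def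
      by (rule stopped_gains_lower_bound(2)[where n = n]) (use H(2) C in auto)
    show "R * indicator B \<omega> \<le> ?U \<omega>"
    proof (cases "\<omega> \<in> B")
      case True
      have "V \<omega> = G M n \<omega>"
        unfolding V_def D_def ok_def G_def
        by (rule stopped_gains_lower_bound(1)[where n = n])
          (use H(2) C B(2)[OF True] in \<open>auto simp: G_def\<close>)
      moreover have "0 \<le> (\<Sum>j\<le>n. E j \<omega> * \<bar>M (t j) \<omega>\<bar>)"
        by (intro sum_nonneg mult_nonneg_nonneg E01) auto
      ultimately show ?thesis using B(3)[OF True] True C by simp
    next
      case False
      then show ?thesis using lb by simp
    qed
  qed
  also have "\<dots> = (C + K) + (\<Sum>j\<le>n. \<integral>\<omega>. E j \<omega> * \<bar>M (t j) \<omega>\<bar> \<partial>P)"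
  proof -
    have "integrable P (\<lambda>\<omega>. V \<omega> + (C + K))"
      using V(1) by simp
    moreover have "integrable P (\<lambda>\<omega>. \<Sum>j\<le>n. E j \<omega> * \<bar>M (t j) \<omega>\<bar>)"
      using intE by (intro Bochner_Integration.integrable_sum) auto
    moreover have "(\<integral>\<omega>. (\<Sum>j\<le>n. E j \<omega> * \<bar>M (t j) \<omega>\<bar>) \<partial>P) = (\<Sum>j\<le>n. \<integral>\<omega>. E j \<omega> * \<bar>M (t j) \<omega>\<bar> \<partial>P)"
      using intE by (subst Bochner_Integration.integral_sum) auto
    moreover have "(\<integral>\<omega>. V \<omega> + (C + K) \<partial>P) = C + K"
      using V by (simp add: prob_space)
    ultimately show ?thesis
      by (subst Bochner_Integration.integral_add) simp_all
  qed
  finally show ?thesis using S by simp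
qed


section \<open>Variation of Brownian paths along equidistant grids\<close>

text \<open>
  Used to replace a bound that is finite almost surely by a constant, at the price of an event of
  small probability.
\<close>

lemma (in prob_space) prob_gt_if_AE_eventually:
  assumes "\<And>m::nat. A m \<in> events" "AE \<omega> in M. \<exists>m. \<forall>j\<ge>m. \<omega> \<in> A j" "c < 1"
  shows "\<exists>m. c < prob (A m)"
proof -
  let ?B = "\<lambda>m. \<Inter>j\<in>{m..}. A j"
  have B: "?B m \<in> events" for m
    using assms(1) by (intro sets.countable_INT') auto
  have "(\<lambda>m. prob (?B m)) \<longlonglongrightarrow> prob (\<Union>m. ?B m)"
    using B by (intro finite_Lim_measure_incseq) (auto simp: incseq_def)
  also have "prob (\<Union>m. ?B m) = 1"
  proof (subst prob_eq_1)
    show "(\<Union>m. ?B m) \<in> events"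
      using B by auto
    show "AE \<omega> in M. \<omega> \<in> (\<Union>m. ?B m)"
      using assms(2) by eventually_elim auto
  qed
  finally have "\<forall>\<^sub>F m in sequentially. c < prob (?B m)"
    using assms(3) by (rule order_tendstoD(1))
  then obtain m where "c < prob (?B m)"
    by (auto simp: eventually_sequentially)
  also have "prob (?B m) \<le> prob (A m)"
    using assms(1) by (intro finite_measure_mono) auto
  finally show ?thesis by blast
qed

lemma expectation_exp_neg_abs_normal_less_1:
  "(\<integral>x. std_normal_density x * exp (- \<bar>x\<bar>) \<partial>lborel) < 1"
proof -
  let ?N = "density lborel std_normal_density"
  interpret N: prob_space ?N by (rule prob_space_normal_density) simp
  have "AE x in lborel. x \<noteq> (0::real)"
    by (rule AE_lborel_singleton)
  then have "AE x in ?N. exp (- \<bar>x\<bar>) < 1"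
    by (simp add: AE_density) (auto elim!: eventually_mono)
  then have "N.expectation (\<lambda>x. exp (- \<bar>x\<bar>)) < 1"
    by (intro N.expectation_less N.integrable_const_bound[where B = 1]) auto
  then show ?thesis
    by (subst (asm) integral_real_density) (auto simp: normal_density_nonneg)
qed

text \<open>
  With \<open>l = sqrt (n / a)\<close> the rescaled increments \<open>l * Y i\<close> are independent standard normal
  variables, so the Laplace transform of the variation \<open>L n\<close> at \<open>l\<close> is \<open>q ^ n\<close> with
  \<open>q = E (exp (- \<bar>Z\<bar>)) < 1\<close> for a standard normal \<open>Z\<close>. Markov's inequality gives
  \<open>P (L n < R) \<le> exp (R * l) * q ^ n\<close>, and \<open>q ^ n\<close> wins because \<open>l\<close> grows only like \<open>sqrt n\<close>.
\<close>

lemma brownian_variation_unbounded: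
  assumes "prob_space P" "standard_brownian_motion P T W" "0 < a" "a \<le> T" "c < 1" "0 < R"
  shows "\<exists>n>0. c < measure P {\<omega>\<in>space P.
    R \<le> (\<Sum>i<n. \<bar>W (real (Suc i) * a / real n) \<omega> - W (real i * a / real n) \<omega>\<bar>)}"
proof -
  interpret prob_space P by fact
  note bm = assms(2)[unfolded standard_brownian_motion_def]
  define q where "q = (\<integral>x. std_normal_density x * exp (- \<bar>x\<bar>) \<partial>lborel)"
  have q0: "0 \<le> q"
    unfolding q_def by (intro integral_nonneg_AE) (auto simp: normal_density_nonneg)
  have q1: "q < 1"
    unfolding q_def by (rule expectation_exp_neg_abs_normal_less_1)
  define L where "L n \<omega> = (\<Sum>i<n. \<bar>W (real (Suc i) * a / real n) \<omega> - W (real i * a / real n) \<omega>\<bar>)"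
    for n \<omega>
  have bound: "prob {\<omega>\<in>space P. L n \<omega> < R} \<le> exp (R * sqrt (real n / a)) * q ^ n"
    and ev: "L n \<in> borel_measurable P" if n: "0 < n" for n
  proof -
    define s where "s i = real i * a / real n" for i
    define Y where "Y i \<omega> = W (s (Suc i)) \<omega> - W (s i) \<omega>" for i \<omega>
    define l where "l = sqrt (real n / a)"
    have l: "0 < l" "sqrt (a / real n) = 1 / l"
      using n assms(3) by (auto simp: l_def real_sqrt_divide)
    have s: "mono_on {..n} s" "s ` {..n} \<subseteq> {0..T}"
    proof -
      show "mono_on {..n} s"
        using assms(3) by (intro mono_onI) (auto simp: s_def divide_right_mono)
      have "s i \<le> a" if "i \<le> n" for i
        using that n assms(3) by (simp add: s_def field_simps)
      then show "s ` {..n} \<subseteq> {0..T}"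
        using assms(3,4) by (fastforce simp: s_def)
    qed
    have Ym: "Y i \<in> borel_measurable P" if "i < n" for i
    proof -
      have "i \<in> {..n}" "Suc i \<in> {..n}" using that by auto
      then have "s i \<in> {0..T}" "s (Suc i) \<in> {0..T}" using s(2) by blast+
      then have "W (s i) \<in> borel_measurable P" "W (s (Suc i)) \<in> borel_measurable P"
        using bm by auto
      then show ?thesis unfolding Y_def by measurable
    qed
    have L_eq: "L n \<omega> = (\<Sum>i<n. \<bar>Y i \<omega>\<bar>)" for \<omega>
      by (simp add: L_def Y_def s_def)
    have "(\<lambda>\<omega>. \<Sum>i<n. \<bar>Y i \<omega>\<bar>) \<in> borel_measurable P"
      using Ym by (intro borel_measurable_sum borel_measurable_abs) auto
    then show Lm: "L n \<in> borel_measurable P"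
      by (simp add: L_eq[abs_def])
    have "indep_vars (\<lambda>_. borel) Y {..<n}"
      using bm s by (simp add: Y_def[abs_def])
    then have ind: "indep_vars (\<lambda>_. borel) (\<lambda>i \<omega>. exp (- (l * \<bar>Y i \<omega>\<bar>))) {..<n}"
      by (rule indep_vars_compose2) auto
    have E1: "expectation (\<lambda>\<omega>. exp (- (l * \<bar>Y i \<omega>\<bar>))) = q" if "i < n" for i
    proof -
      have "i \<in> {..n}" "Suc i \<in> {..n}" using that by auto
      then have "s i \<in> {0..T}" "s (Suc i) \<in> {0..T}" using s(2) by blast+
      moreover have "s i < s (Suc i)"
        using n assms(3) by (auto simp: s_def divide_strict_right_mono)
      ultimately have "s i \<in> {0..T}" "s (Suc i) \<in> {s i<..T}" by auto
      then have "distributed P lborel (Y i) (normal_density 0 (sqrt (s (Suc i) - s i)))"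
        unfolding Y_def using bm by blast
      also have "s (Suc i) - s i = a / real n"
        by (simp add: s_def diff_divide_distrib[symmetric] algebra_simps)
      finally have "distributed P lborel (Y i) (normal_density 0 (1 / l))"
        by (simp only: l)
      then have "distributed P lborel (\<lambda>\<omega>. l * Y i \<omega>) std_normal_density"
        using l(1) by (subst (asm) normal_standard_normal_convert) (auto simp: mult.commute)
      from distributed_integral[OF this, of "\<lambda>x. exp (- \<bar>x\<bar>)"]
      show ?thesis using l(1) by (simp add: q_def abs_mult normal_density_nonneg)
    qed
    have bd: "integrable P (\<lambda>\<omega>. exp (- (l * \<bar>Y i \<omega>\<bar>)))" if "i < n" for i
      using Ym[OF that] l(1) by (intro integrable_const_bound[where B = 1]) auto
    have exp_eq: "exp (- (l * L n \<omega>)) = (\<Prod>i<n. exp (- (l * \<bar>Y i \<omega>\<bar>)))" for \<omega>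
      by (simp add: L_eq sum_distrib_left sum_negf[symmetric] exp_sum)
    have "expectation (\<lambda>\<omega>. exp (- (l * L n \<omega>))) = (\<Prod>i<n. expectation (\<lambda>\<omega>. exp (- (l * \<bar>Y i \<omega>\<bar>))))"
      unfolding exp_eq using ind bd by (intro indep_vars_lebesgue_integral) auto
    also have "\<dots> = q ^ n"
      using E1 by simp
    finally have E: "expectation (\<lambda>\<omega>. exp (- (l * L n \<omega>))) = q ^ n" .
    have L0: "0 \<le> L n \<omega>" for \<omega> by (simp add: L_eq sum_nonneg)
    have intL: "integrable P (\<lambda>\<omega>. exp (- (l * L n \<omega>)))"
      using Lm l(1) L0 by (intro integrable_const_bound[where B = 1]) auto
    have set: "{\<omega>\<in>space P. L n \<omega> < R} \<in> events"
      using Lm by measurable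
    have "prob {\<omega>\<in>space P. L n \<omega> < R} = expectation (indicator {\<omega>\<in>space P. L n \<omega> < R})"
      using set by simp
    also have "\<dots> \<le> expectation (\<lambda>\<omega>. exp (R * l) * exp (- (l * L n \<omega>)))"
    proof (rule integral_mono)
      show "integrable P (\<lambda>\<omega>. exp (R * l) * exp (- (l * L n \<omega>)))"
        using intL by simp
      show "indicator {\<omega>\<in>space P. L n \<omega> < R} \<omega> \<le> exp (R * l) * exp (- (l * L n \<omega>))" for \<omega>
        using l(1) by (auto simp: indicator_def exp_add[symmetric] mult.commute)
    qed (use set in \<open>simp add: emeasure_eq_measure\<close>)
    also have "\<dots> = exp (R * l) * q ^ n"
      using E by simp
    finally show "prob {\<omega>\<in>space P. L n \<omega> < R} \<le> exp (R * sqrt (real n / a)) * q ^ n"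
      by (simp add: l_def)
  qed
  \<comment> \<open>\<open>q\<close> is replaced by a positive bound so that its logarithm can be taken.\<close>
  define r where "r = max q (1/2)"
  have r: "0 < r" "r < 1" "q \<le> r" using q1 by (auto simp: r_def)
  have "(\<lambda>n. exp (R * sqrt (real n / a)) * r ^ n) \<longlonglongrightarrow> 0"
  proof -
    define k c where "k = - ln r" and "c = R / sqrt a"
    have k: "0 < k" "0 < c" using r assms(3,6) by (auto simp: k_def c_def)
    then have "(\<lambda>n. exp (c * sqrt (real n) - k * real n)) \<longlonglongrightarrow> 0"
      by real_asymp
    also have "(\<lambda>n. exp (c * sqrt (real n) - k * real n)) = (\<lambda>n. exp (R * sqrt (real n / a)) * r ^ n)"
    proof
      fix n
      have "exp (- (k * real n)) = r ^ n"
        using r by (simp add: k_def exp_of_nat2_mult)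
      then show "exp (c * sqrt (real n) - k * real n) = exp (R * sqrt (real n / a)) * r ^ n"
        by (simp add: c_def real_sqrt_divide exp_diff exp_minus field_simps)
    qed
    finally show ?thesis .
  qed
  then have "\<forall>\<^sub>F n in sequentially. exp (R * sqrt (real n / a)) * r ^ n < 1 - c"
    using assms(5) by (intro order_tendstoD(2)) auto
  then have "\<forall>\<^sub>F n in sequentially. exp (R * sqrt (real n / a)) * r ^ n < 1 - c \<and> 0 < n"
    using eventually_gt_at_top[of 0] by (rule eventually_conj)
  then obtain n where n: "exp (R * sqrt (real n / a)) * r ^ n < 1 - c" "0 < n"
    by (auto dest: eventually_happens)
  have "exp (R * sqrt (real n / a)) * q ^ n \<le> exp (R * sqrt (real n / a)) * r ^ n"
    using q0 r by (intro mult_left_mono power_mono) auto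
  then have "prob {\<omega>\<in>space P. L n \<omega> < R} < 1 - c"
    using bound[OF n(2)] n(1) by linarith
  moreover have "prob {\<omega>\<in>space P. \<not> L n \<omega> < R} = 1 - prob {\<omega>\<in>space P. L n \<omega> < R}"
    using ev[OF n(2)] by (intro prob_neg) measurable
  ultimately show ?thesis
    using n(2) unfolding L_def by (auto simp: not_less)
qed


section \<open>The delayed path plus its moving integral\<close>

text \<open>
  The measure \<open>\<delta>\<^bsub>-a\<^esub> + dx\<close> on \<open>[-a,0]\<close>. Along the window process the Dirac mass yields the delayed
  path, and the integral discloses the present value without adding any irregularity.
\<close>

definition delay_functional :: "real \<Rightarrow> (real \<Rightarrow>\<^sub>C real) \<Rightarrow> real" where
  "delay_functional a f = apply_bcontfun f (- a) + integral {- a..0} (apply_bcontfun f)"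

lemma delay_functional_in_dual_space:
  assumes "0 \<le> a"
  shows "delay_functional a \<in> dual_space B"
proof -
  have int: "apply_bcontfun f integrable_on {- a..0}" for f :: "real \<Rightarrow>\<^sub>C real"
    by (intro integrable_continuous_real continuous_on_apply_bcontfun)
  have "\<bar>delay_functional a f\<bar> \<le> (1 + a) * norm f" for f
  proof -
    have "norm (integral {- a..0} (apply_bcontfun f)) \<le> norm f * (0 - (- a))"
      using assms by (intro integral_bound continuous_on_apply_bcontfun norm_bounded) auto
    then have "\<bar>integral {- a..0} (apply_bcontfun f)\<bar> \<le> norm f * a"
      by simp
    moreover have "\<bar>apply_bcontfun f (- a)\<bar> \<le> norm f"
      using norm_bounded[of f "- a"] by simp
    ultimately show ?thesis
      unfolding delay_functional_def by (simp add: algebra_simps)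
  qed
  then have "\<exists>K. \<forall>f\<in>B. \<bar>delay_functional a f\<bar> \<le> K * norm f" by blast
  moreover have "delay_functional a (f + g) = delay_functional a f + delay_functional a g" for f g
    using int by (simp add: delay_functional_def plus_bcontfun.rep_eq
        Henstock_Kurzweil_Integration.integral_add)
  moreover have "delay_functional a (c *\<^sub>R f) = c * delay_functional a f" for c f
    by (simp add: delay_functional_def scaleR_bcontfun.rep_eq algebra_simps)
  ultimately show ?thesis
    by (simp add: dual_space_def)
qed

lemma extended_process_inside: "t \<in> {0..T} \<Longrightarrow> extended_process T W t \<omega> = W t \<omega>"
  by (cases "t = 0"; cases "t = T") (auto simp: extended_process_def)

text \<open>
  An antiderivative \<open>J\<close> of the extended path turns the integral over the moving window into
  \<open>J t - J (t - a)\<close>, whose two terms can be studied separately.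
\<close>

lemma delay_functional_window_process:
  assumes "0 < a" "a \<le> \<tau>" "0 < T" "continuous_on {0..T} (\<lambda>t. W t \<omega>)"
  obtains J where
    "\<And>v. v \<in> {- a..T} \<Longrightarrow> (J has_real_derivative extended_process T W v \<omega>) (at v)"
    "\<And>t. t \<in> {0..T} \<Longrightarrow> delay_functional a (window_process T \<tau> W t \<omega>)
       = extended_process T W (t - a) \<omega> + (J t - J (t - a))"
proof -
  let ?e = "\<lambda>v. extended_process T W v \<omega>"
  have cont: "continuous_on S ?e" for S
    using continuous_extended_process[where W = W and \<omega> = \<omega>, OF assms(3,4)] .
  obtain J where J: "\<And>v. v \<in> {- a - 1..T + 1} \<Longrightarrow>
      (J has_vector_derivative ?e v) (at v within {- a - 1..T + 1})"
    using antiderivative_continuous[OF cont] by blast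
  have D: "(J has_real_derivative ?e v) (at v)" if "v \<in> {- a..T}" for v
  proof -
    have "v \<in> interior {- a - 1..T + 1}" using that by simp
    then have "at v within {- a - 1..T + 1} = at v"
      by (rule at_within_interior)
    moreover have "v \<in> {- a - 1..T + 1}" using that by simp
    ultimately show ?thesis
      using J[of v] by (simp only: has_real_derivative_iff_has_vector_derivative)
  qed
  have "delay_functional a (window_process T \<tau> W t \<omega>) = ?e (t - a) + (J t - J (t - a))"
    if t: "t \<in> {0..T}" for t
  proof -
    note app = window_process_apply[where W = W and \<omega> = \<omega>, OF assms(3) less_le_trans[OF assms(1,2)] assms(4)]
    have "((\<lambda>x. ?e (t + x)) has_integral (J (t + 0) - J (t + (- a)))) {- a..0}"
    proof (rule fundamental_theorem_of_calculus)
      fix x assume x: "x \<in> {- a..0}"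
      have "((\<lambda>x. J (t + x)) has_real_derivative ?e (t + x)) (at x)"
        using DERIV_shift[of J "?e (t + x)" x t] D[of "t + x"] x t by (simp add: add.commute)
      then show "((\<lambda>x. J (t + x)) has_vector_derivative ?e (t + x)) (at x within {- a..0})"
        by (simp add: has_real_derivative_iff_has_vector_derivative has_vector_derivative_at_within)
    qed (use assms(1) in simp)
    then have "integral {- a..0} (\<lambda>x. ?e (t + x)) = J t - J (t - a)"
      by (simp add: integral_unique)
    moreover have "integral {- a..0} (apply_bcontfun (window_process T \<tau> W t \<omega>))
        = integral {- a..0} (\<lambda>x. ?e (t + x))"
      using assms(2) by (intro Henstock_Kurzweil_Integration.integral_cong app) auto
    ultimately show ?thesis
      using assms(1,2) by (simp add: delay_functional_def app)
  qed
  with D that show thesis by blast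
qed

text \<open>
  Up to time \<open>a\<close> the delayed path still has its initial value, so the functional is continuously
  differentiable in time with derivative \<open>W u - W 0\<close>. Left difference quotients are taken because
  they only involve times up to \<open>u\<close>: the observed process reveals \<open>W u - W 0\<close> at time \<open>u\<close>, in
  every filtration to which it is adapted.
\<close>

lemma delay_functional_difference_quotient_tendsto:
  assumes "0 < a" "a \<le> \<tau>" "a \<le> T" "continuous_on {0..T} (\<lambda>t. W t \<omega>)" "0 < u" "u \<le> a"
  defines "X \<equiv> \<lambda>t. delay_functional a (window_process T \<tau> W t \<omega>)"
  shows "(\<lambda>n. (X u - X (u - u / real (Suc n))) / (u / real (Suc n))) \<longlonglongrightarrow> W u \<omega> - W 0 \<omega>"
proof -
  have T: "0 < T" using assms by simp
  obtain J where J: "\<And>v. v \<in> {- a..T} \<Longrightarrow> (J has_real_derivative extended_process T W v \<omega>) (at v)"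
    and X: "\<And>t. t \<in> {0..T} \<Longrightarrow> X t = extended_process T W (t - a) \<omega> + (J t - J (t - a))"
    unfolding X_def using delay_functional_window_process[where W = W and \<omega> = \<omega>, OF assms(1,2) T assms(4)] by blast
  \<comment> \<open>The (negative) step of the difference quotient.\<close>
  define h where "h n = - u / real (Suc n)" for n
  have h0: "h n < 0" "0 \<le> u + h n" for n
    using assms(5) by (auto simp: h_def field_simps)
  have diff: "X u - X (u + h n) = J u - J (u + h n) + h n * W 0 \<omega>" for n
  proof -
    have "\<exists>z>u + h n - a. z < u - a \<and>
        J (u - a) - J (u + h n - a) = (u - a - (u + h n - a)) * extended_process T W z \<omega>"
      using h0[of n] assms T by (intro MVT2 J) auto
    then have "J (u - a) - J (u + h n - a) = - h n * W 0 \<omega>"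
      using assms(6) by (auto simp: extended_process_def)
    then show ?thesis
      using X[of u] X[of "u + h n"] h0[of n] assms T by (simp add: extended_process_def)
  qed
  have "((\<lambda>k. (J (u + k) - J u) / k) \<longlongrightarrow> W u \<omega>) (at 0)"
  proof -
    have "extended_process T W u \<omega> = W u \<omega>"
      using assms(3,5,6) by (intro extended_process_inside) auto
    then show ?thesis using J[of u] assms(1,3,5,6) by (simp add: DERIV_def)
  qed
  moreover have "filterlim h (at 0) sequentially"
  proof (rule filterlim_atI)
    show "h \<longlonglongrightarrow> 0"
      unfolding h_def[abs_def]
      by (rule real_tendsto_divide_at_top[OF tendsto_const
            filterlim_compose[OF filterlim_real_sequentially filterlim_Suc]])
    show "\<forall>\<^sub>F n in sequentially. h n \<noteq> 0"
      using h0 by (intro always_eventually) (auto simp: less_imp_neq)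
  qed
  ultimately have lim: "(\<lambda>n. (J (u + h n) - J u) / h n - W 0 \<omega>) \<longlonglongrightarrow> W u \<omega> - W 0 \<omega>"
    by (intro tendsto_diff tendsto_const) (rule filterlim_compose)
  have quot: "(J (u + h n) - J u) / h n - W 0 \<omega> = (X u - X (u - u / real (Suc n))) / (u / real (Suc n))" for n
  proof -
    have "(X u - X (u + h n)) / - h n = (J (u + h n) - J u) / h n - W 0 \<omega>"
      unfolding diff using h0(1)[of n] by (simp add: field_simps)
    then show ?thesis by (simp add: h_def)
  qed
  show ?thesis
    using lim unfolding quot .
qed

lemma delay_functional_minus_delay_lipschitz:
  assumes "0 < a" "a \<le> \<tau>" "a \<le> T" "continuous_on {0..T} (\<lambda>t. W t \<omega>)"
  defines "I \<equiv> \<lambda>t. delay_functional a (window_process T \<tau> W t \<omega>) - W (t - a) \<omega>"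
  shows "\<exists>S. \<forall>s\<in>{a..T}. \<forall>t\<in>{a..T}. \<bar>I t - I s\<bar> \<le> S * \<bar>t - s\<bar>"
proof -
  have T: "0 < T" using assms by simp
  obtain J where J: "\<And>v. v \<in> {- a..T} \<Longrightarrow> (J has_real_derivative extended_process T W v \<omega>) (at v)"
    and X: "\<And>t. t \<in> {0..T} \<Longrightarrow> delay_functional a (window_process T \<tau> W t \<omega>)
       = extended_process T W (t - a) \<omega> + (J t - J (t - a))"
    using delay_functional_window_process[where W = W and \<omega> = \<omega>, OF assms(1,2) T assms(4)] by blast
  have "bounded ((\<lambda>t. W t \<omega>) ` {0..T})"
    using assms(4) by (intro compact_imp_bounded compact_continuous_image) auto
  then obtain S where "\<forall>x\<in>(\<lambda>t. W t \<omega>) ` {0..T}. norm x \<le> S"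
    unfolding bounded_iff by blast
  then have S: "\<bar>W t \<omega>\<bar> \<le> S" if "t \<in> {0..T}" for t
    using that by simp
  have lip: "\<bar>J t - J s\<bar> \<le> S * (t - s)" if "0 \<le> s" "s < t" "t \<le> T" for s t
  proof -
    have "\<exists>z>s. z < t \<and> J t - J s = (t - s) * extended_process T W z \<omega>"
      using that assms(1) by (intro MVT2 J) auto
    then obtain z where z: "s < z" "z < t" "J t - J s = (t - s) * extended_process T W z \<omega>"
      by blast
    moreover have "extended_process T W z \<omega> = W z \<omega>"
      using z that by (intro extended_process_inside) auto
    ultimately have z: "s < z" "z < t" "J t - J s = (t - s) * W z \<omega>"
      by simp_all
    have "\<bar>J t - J s\<bar> = \<bar>W z \<omega>\<bar> * (t - s)"
      using z(3) that(2) by (simp add: abs_mult)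
    also have "\<dots> \<le> S * (t - s)"
      using z(1,2) that by (intro mult_right_mono S) auto
    finally show ?thesis .
  qed
  have eq: "I t = J t - J (t - a)" if "t \<in> {a..T}" for t
  proof -
    have "extended_process T W (t - a) \<omega> = W (t - a) \<omega>"
      using that assms(1) by (intro extended_process_inside) auto
    then show ?thesis using X[of t] that assms(1) by (simp add: I_def)
  qed
  have *: "\<bar>I t - I s\<bar> \<le> 2 * S * (t - s)" if "s \<in> {a..T}" "t \<in> {a..T}" "s < t" for s t
  proof -
    have "\<bar>J t - J s\<bar> \<le> S * (t - s)"
      using that assms(1) by (intro lip) auto
    moreover have "\<bar>J (t - a) - J (s - a)\<bar> \<le> S * (t - a - (s - a))"
      using that assms(1) by (intro lip) auto
    then have "\<bar>J (t - a) - J (s - a)\<bar> \<le> S * (t - s)"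
      by simp
    moreover have "2 * S * (t - s) = S * (t - s) + S * (t - s)"
      by simp
    ultimately show ?thesis
      unfolding eq[OF that(1)] eq[OF that(2)] by linarith
  qed
  have "\<bar>I t - I s\<bar> \<le> 2 * S * \<bar>t - s\<bar>" if "s \<in> {a..T}" "t \<in> {a..T}" for s t
  proof (cases s t rule: linorder_cases)
    case less
    have "\<bar>t - s\<bar> = t - s" using less by simp
    then show ?thesis using *[OF that less] by (simp only:)
  next
    case equal
    then show ?thesis by simp
  next
    case greater
    have "\<bar>I t - I s\<bar> = \<bar>I s - I t\<bar>"
      by (rule abs_minus_commute)
    moreover have "\<bar>t - s\<bar> = s - t"
      using greater by simp
    ultimately show ?thesis using *[OF that(2,1) greater] by (simp only:)
  qed
  then show ?thesis by blast
qed


section \<open>Trading on a delayed Brownian path\<close>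

lemma abs_diff_le_sum_increments:
  fixes f :: "nat \<Rightarrow> real"
  assumes "k \<le> n"
  shows "\<bar>f k - f 0\<bar> \<le> (\<Sum>i<n. \<bar>f (Suc i) - f i\<bar>)"
proof -
  have "\<bar>f k - f 0\<bar> = \<bar>\<Sum>i<k. f (Suc i) - f i\<bar>"
    by (simp add: sum_lessThan_telescope)
  also have "\<dots> \<le> (\<Sum>i<k. \<bar>f (Suc i) - f i\<bar>)"
    by (rule sum_abs)
  also have "\<dots> \<le> (\<Sum>i<n. \<bar>f (Suc i) - f i\<bar>)"
    using assms by (intro sum_mono2) auto
  finally show ?thesis .
qed

lemma (in prob_space) prob_Int_ge:
  assumes "A \<in> events" "B \<in> events"
  shows "prob A + prob B - 1 \<le> prob (A \<inter> B)"
proof -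
  have "prob (A \<union> B) = prob A + prob B - prob (A \<inter> B)"
    using assms by (intro measure_Un3) (auto simp: fmeasurable_eq_sets)
  then show ?thesis
    using prob_le_1[of "A \<union> B"] by linarith
qed

text \<open>
  Betting on the sign of the increments of \<open>w\<close> in the sequence \<open>w - v\<close> gains the variation of \<open>w\<close>,
  up to the variation of \<open>v\<close>.
\<close>

lemma signed_increments_lower_bound:
  fixes w v :: "nat \<Rightarrow> real"
  assumes "k \<le> n"
  defines "sg \<equiv> \<lambda>i. if 0 \<le> w (Suc i) - w i then 1 else - 1 :: real"
  shows "(\<Sum>i<k. \<bar>w (Suc i) - w i\<bar>) - (\<Sum>i<n. \<bar>v (Suc i) - v i\<bar>)
      \<le> (\<Sum>i<k. sg i * ((w (Suc i) - v (Suc i)) - (w i - v i)))"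
proof -
  have "(\<Sum>i<k. \<bar>w (Suc i) - w i\<bar>) - (\<Sum>i<n. \<bar>v (Suc i) - v i\<bar>)
      \<le> (\<Sum>i<k. \<bar>w (Suc i) - w i\<bar>) - (\<Sum>i<k. \<bar>v (Suc i) - v i\<bar>)"
    using assms(1) by (intro diff_left_mono sum_mono2) auto
  also have "\<dots> \<le> (\<Sum>i<k. sg i * ((w (Suc i) - v (Suc i)) - (w i - v i)))"
    unfolding sum_subtractf[symmetric] by (intro sum_mono) (auto simp: sg_def)
  finally show ?thesis .
qed

text \<open>
  Suppose \<open>X = N + A\<close>. On \<open>[a,T]\<close> the delayed path \<open>W (t - a)\<close> differs from the local martingale \<open>N\<close>
  by a process \<open>V\<close> of finite variation. Over a step \<open>[t\<^sub>i, t\<^sub>i\<^sub>+\<^sub>1]\<close> of a grid in \<open>[a, 2 * a]\<close>, the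
  sign of the increment of the delayed path depends on \<open>W\<close> on \<open>[0,a]\<close> only and is known at time
  \<open>t\<^sub>i \<ge> a\<close>. Trading in \<open>N\<close> according to it gains at least the variation of \<open>W\<close> on the corresponding
  grid of \<open>[0,a]\<close> minus the variation of \<open>V\<close>: never less than a fixed negative level, and
  arbitrarily much in the end as the grid is refined, with probability bounded away from \<open>0\<close>. After localization this
  contradicts \<open>martingale_gains_bound\<close>.
\<close>

lemma semimartingale_not_anticipated_delayed_brownian:
  assumes "prob_space P" "standard_brownian_motion P T W" "0 < a" "2 * a \<le> T"
    and F: "filtration_on P F" and X: "semimartingale P F T X"
    and past: "\<And>u. u \<in> {0..a} \<Longrightarrow> (\<lambda>\<omega>. W u \<omega> - W 0 \<omega>) \<in> borel_measurable (F u)"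
    and lip: "\<And>\<omega>. \<omega> \<in> space P \<Longrightarrow> \<exists>S. \<forall>s\<in>{a..T}. \<forall>t\<in>{a..T}.
      \<bar>(X t \<omega> - W (t - a) \<omega>) - (X s \<omega> - W (s - a) \<omega>)\<bar> \<le> S * \<bar>t - s\<bar>"
  shows False
proof -
  interpret prob_space P by fact
  note bm = assms(2)[unfolded standard_brownian_motion_def]
  note P = filtration_on_borel_measurable[OF F]
  obtain N A where N: "local_martingale P F T N" and A: "finite_variation_process P F T A"
    and XNA: "AE \<omega> in P. \<forall>t\<in>{0..T}. X t \<omega> = N t \<omega> + A t \<omega>"
    using X by (auto simp: semimartingale_def)
  have T: "0 < T" "a \<le> T" using assms(3,4) by auto
  have NP: "N t \<in> borel_measurable P" if "t \<in> {0..T}" for t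
    using N that by (intro P[of _ t]) (auto simp: local_martingale_def adapted_def)
  have WP: "W t \<in> borel_measurable P" if "t \<in> {0..T}" for t
    using bm that by blast
  define u :: "nat \<Rightarrow> nat \<Rightarrow> real" where "u n i = real i * a / real n" for n i
  define t :: "nat \<Rightarrow> nat \<Rightarrow> real" where "t n i = a + u n i" for n i
  define V where "V s \<omega> = W (s - a) \<omega> - N s \<omega>" for s \<omega>
  have u: "0 \<le> u n i" "u n i \<le> a" if "i \<le> n" for n i
    using that assms(3) by (cases "n = 0"; simp add: u_def field_simps)+
  have umono: "u n i \<le> u n j" if "i \<le> j" for n i j
    using that assms(3) by (simp add: u_def divide_right_mono mult_right_mono)
  have t: "t n i \<in> {a..T}" "t n i \<in> {0..T}" "t n i - a \<in> {0..T}" if "i \<le> n" for n i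
    using u[OF that] assms(3,4) by (auto simp: t_def)
  have VP: "V (t n i) \<in> borel_measurable P" if "i \<le> n" for n i
    unfolding V_def[abs_def] using t[OF that] by (intro borel_measurable_diff WP NP)
  define var where "var n \<omega> = (\<Sum>i<n. \<bar>V (t n (Suc i)) \<omega> - V (t n i) \<omega>\<bar>)" for n \<omega>
  define L where "L n \<omega> = (\<Sum>i<n. \<bar>W (u n (Suc i)) \<omega> - W (u n i) \<omega>\<bar>)" for n \<omega>
  \<comment> \<open>On \<open>B m\<close>, the single number \<open>m\<close> controls all grids simultaneously; it is therefore chosen
    before the grid.\<close>
  define B where "B m = {\<omega>\<in>space P. \<forall>n. var n \<omega> \<le> real m \<and> (\<forall>k\<in>{..n}. \<bar>N (t n k) \<omega> - N 0 \<omega>\<bar> \<le> real m)}"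
    for m
  have varP: "var n \<in> borel_measurable P" for n
    unfolding var_def[abs_def] using VP
    by (intro borel_measurable_sum borel_measurable_abs borel_measurable_diff) auto
  have B_ev: "B m \<in> events" for m
  proof -
    have "Measurable.pred P (\<lambda>\<omega>. \<bar>N (t n k) \<omega> - N 0 \<omega>\<bar> \<le> real m)" if "k \<in> {..n}" for n k
    proof -
      have [measurable]: "N (t n k) \<in> borel_measurable P" "N 0 \<in> borel_measurable P"
        using t(2)[of k n] that T by (auto intro!: NP)
      show ?thesis by measurable
    qed
    moreover have "Measurable.pred P (\<lambda>\<omega>. var n \<omega> \<le> real m)" for n
      using varP[of n] by measurable
    ultimately have "Measurable.pred P (\<lambda>\<omega>. \<forall>n. var n \<omega> \<le> real m \<and> (\<forall>k\<in>{..n}. \<bar>N (t n k) \<omega> - N 0 \<omega>\<bar> \<le> real m))"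
      by (intro pred_intros_countable pred_intros_logic pred_intros_finite) auto
    then show ?thesis
      unfolding B_def by (simp only: pred_def)
  qed
  have B_mono: "B m \<subseteq> B m'" if "m \<le> m'" for m m'
  proof -
    have "real m \<le> real m'" using that by simp
    then show ?thesis
      unfolding B_def by (auto intro!: order_trans[OF _ \<open>real m \<le> real m'\<close>])
  qed
  have B_AE: "AE \<omega> in P. \<exists>m. \<forall>j\<ge>m. \<omega> \<in> B j"
  proof -
    have BV: "AE \<omega> in P. bounded_variation T (\<lambda>t. A t \<omega>)"
      using A by (auto simp: finite_variation_process_def)
    show ?thesis
      using XNA BV AE_space
    proof eventually_elim
      fix \<omega> assume XNA: "\<forall>t\<in>{0..T}. X t \<omega> = N t \<omega> + A t \<omega>"
        and "bounded_variation T (\<lambda>t. A t \<omega>)" and \<omega>: "\<omega> \<in> space P"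
      then obtain K where K: "\<And>n (s :: nat \<Rightarrow> real). mono_on {..n} s \<Longrightarrow> s ` {..n} \<subseteq> {0..T} \<Longrightarrow>
          (\<Sum>i<n. \<bar>A (s (Suc i)) \<omega> - A (s i) \<omega>\<bar>) \<le> K"
        unfolding bounded_variation_def by blast
      obtain S where S: "\<And>s t. s \<in> {a..T} \<Longrightarrow> t \<in> {a..T} \<Longrightarrow>
          \<bar>(X t \<omega> - W (t - a) \<omega>) - (X s \<omega> - W (s - a) \<omega>)\<bar> \<le> S * \<bar>t - s\<bar>"
        using lip[OF \<omega>] by blast
      have "bounded ((\<lambda>t. W t \<omega>) ` {0..T})"
        using bm \<omega> by (intro compact_imp_bounded compact_continuous_image) auto
      then obtain w where "\<forall>x\<in>(\<lambda>t. W t \<omega>) ` {0..T}. norm x \<le> w"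
        unfolding bounded_iff by blast
      then have w: "\<bar>W t \<omega>\<bar> \<le> w" if "t \<in> {0..T}" for t
        using that by simp
      have var: "var n \<omega> \<le> K + \<bar>S\<bar> * a" for n
      proof -
        have "\<bar>V (t n (Suc i)) \<omega> - V (t n i) \<omega>\<bar>
            \<le> \<bar>A (t n (Suc i)) \<omega> - A (t n i) \<omega>\<bar> + \<bar>S\<bar> * (t n (Suc i) - t n i)" if "i < n" for i
        proof -
          have i: "t n i \<in> {a..T}" "t n (Suc i) \<in> {a..T}" "t n i \<in> {0..T}" "t n (Suc i) \<in> {0..T}"
            using that by (auto intro!: t simp del: atLeastAtMost_iff)
          have d: "0 \<le> t n (Suc i) - t n i"
            using umono[of i "Suc i" n] by (simp add: t_def)
          have "S * \<bar>t n (Suc i) - t n i\<bar> \<le> \<bar>S\<bar> * (t n (Suc i) - t n i)"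
            using d by (simp add: mult_right_mono)
          then show ?thesis
            using S[OF i(1,2)] XNA[rule_format, OF i(3)] XNA[rule_format, OF i(4)]
            unfolding V_def by linarith
        qed
        then have "var n \<omega> \<le> (\<Sum>i<n. \<bar>A (t n (Suc i)) \<omega> - A (t n i) \<omega>\<bar> + \<bar>S\<bar> * (t n (Suc i) - t n i))"
          unfolding var_def by (intro sum_mono) auto
        also have "\<dots> = (\<Sum>i<n. \<bar>A (t n (Suc i)) \<omega> - A (t n i) \<omega>\<bar>) + \<bar>S\<bar> * (t n n - t n 0)"
          by (simp add: sum.distrib sum_distrib_left[symmetric] sum_lessThan_telescope)
        also have "(\<Sum>i<n. \<bar>A (t n (Suc i)) \<omega> - A (t n i) \<omega>\<bar>) \<le> K"
        proof (rule K)
          show "mono_on {..n} (t n)"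
            using umono by (intro mono_onI) (simp add: t_def)
          show "t n ` {..n} \<subseteq> {0..T}"
            using t(2) by blast
        qed
        also have "\<bar>S\<bar> * (t n n - t n 0) \<le> \<bar>S\<bar> * a"
          using assms(3) by (intro mult_left_mono) (auto simp: t_def u_def)
        finally show ?thesis by simp
      qed
      define m where "m = nat \<lceil>max (K + \<bar>S\<bar> * a) (2 * w + \<bar>N a \<omega>\<bar> + \<bar>N 0 \<omega>\<bar> + w + (K + \<bar>S\<bar> * a))\<rceil>"
      have m: "K + \<bar>S\<bar> * a \<le> real m" "2 * w + \<bar>N a \<omega>\<bar> + \<bar>N 0 \<omega>\<bar> + w + (K + \<bar>S\<bar> * a) \<le> real m"
        unfolding m_def by linarith+
      have "\<bar>N (t n k) \<omega> - N 0 \<omega>\<bar> \<le> real m" if "k \<le> n" for n k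
      proof -
        have "\<bar>V (t n k) \<omega> - V (t n 0) \<omega>\<bar> \<le> K + \<bar>S\<bar> * a"
          using abs_diff_le_sum_increments[OF that, of "\<lambda>i. V (t n i) \<omega>"] var[of n]
          unfolding var_def by linarith
        moreover have "t n 0 = a" by (simp add: t_def u_def)
        moreover have "\<bar>W (t n k - a) \<omega>\<bar> \<le> w" "\<bar>W 0 \<omega>\<bar> \<le> w" "0 \<le> w"
          using w[OF t(3)[OF that]] w[of 0] T by auto
        ultimately show ?thesis using m(2) by (simp add: V_def)
      qed
      then have "\<omega> \<in> B m"
        using \<omega> var m(1) by (auto simp: B_def intro: order_trans)
      then show "\<exists>m. \<forall>j\<ge>m. \<omega> \<in> B j"
        using B_mono by blast
    qed
  qed
  obtain m where m: "7/8 < prob (B m)"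
    using prob_gt_if_AE_eventually[OF B_ev B_AE, where c = "7/8"] by auto
  obtain \<sigma> :: "nat \<Rightarrow> 'a \<Rightarrow> real" where st: "\<And>p. stopping_time F (\<sigma> p)"
    and inc: "AE \<omega> in P. incseq (\<lambda>p. \<sigma> p \<omega>)" and top: "AE \<omega> in P. \<exists>p. T \<le> \<sigma> p \<omega>"
    and mart: "\<And>p. martingale P F T (\<lambda>t \<omega>. N (min t (\<sigma> p \<omega>)) \<omega> - N 0 \<omega>)"
    using N by (auto simp: local_martingale_def)
  define Q where "Q p = {\<omega>\<in>space P. T \<le> \<sigma> p \<omega>}" for p
  have Q_ev: "Q p \<in> events" for p
  proof -
    have "\<sigma> p \<in> borel_measurable P"
      using F by (intro measurable_stopping_time[OF st]) (auto simp: filtration_on_def subalgebra_def)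
    then show ?thesis unfolding Q_def by measurable
  qed
  have Q_AE: "AE \<omega> in P. \<exists>p. \<forall>j\<ge>p. \<omega> \<in> Q j"
    using inc top AE_space by eventually_elim (auto simp: Q_def incseq_def intro: order_trans)
  obtain p where p: "7/8 < prob (Q p)"
    using prob_gt_if_AE_eventually[OF Q_ev Q_AE, where c = "7/8"] by auto
  define M where "M s \<omega> = N (min s (\<sigma> p \<omega>)) \<omega> - N 0 \<omega>" for s \<omega>
  have M: "martingale P F T M"
    using mart[of p] by (simp add: M_def[abs_def])
  define e where "e = (\<integral>\<omega>. \<bar>M (2 * a) \<omega>\<bar> \<partial>P)"
  have "0 \<le> e" by (simp add: e_def)
  \<comment> \<open>Chosen such that \<open>R / 2\<close> exceeds \<open>2 * m + e\<close>, the bound on the gains of all grids.\<close>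
  define R where "R = 2 * (2 * real m + e + 1)"
  obtain n where n: "0 < n" "7/8 < prob {\<omega>\<in>space P. R + real m \<le> L n \<omega>}"
    using brownian_variation_unbounded[OF assms(1-3) T(2), of "7/8" "R + real m"] \<open>0 \<le> e\<close>
    by (auto simp: R_def L_def u_def)
  let ?L = "{\<omega>\<in>space P. R + real m \<le> L n \<omega>}"
  \<comment> \<open>The strategy on the step from \<open>t n i\<close> to \<open>t n (Suc i)\<close>, expressed through \<open>W\<close> at
    \<open>u n i = t n i - a\<close> and \<open>u n (Suc i)\<close>.\<close>
  define H :: "nat \<Rightarrow> 'a \<Rightarrow> real"
    where "H i \<omega> = (if 0 \<le> W (u n (Suc i)) \<omega> - W (u n i) \<omega> then 1 else - 1)" for i \<omega>
  have L_ev: "?L \<in> events"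
  proof -
    have "L n \<in> borel_measurable P"
    proof -
      have "u n i \<in> {0..T}" if "i \<le> n" for i
        using u[OF that] T by auto
      then show ?thesis
        unfolding L_def[abs_def]
        by (intro borel_measurable_sum borel_measurable_abs borel_measurable_diff WP) auto
    qed
    then show ?thesis by measurable
  qed
  let ?G = "B m \<inter> Q p \<inter> ?L"
  have G_ev: "?G \<in> events"
    using B_ev Q_ev L_ev by auto
  have "R * prob ?G \<le> real m + real m + (\<integral>\<omega>. \<bar>M (t n n) \<omega>\<bar> \<partial>P)"
  proof (rule martingale_gains_bound[where H = H and t = "t n" and n = n, OF assms(1) F M])
    show "mono (t n)" using umono by (intro monoI) (simp add: t_def)
    show "0 \<le> t n 0" "t n n \<le> T" using t(2)[of 0 n] t(2)[of n n] by auto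
    show "H i \<in> borel_measurable (F (t n i))" if "i < n" for i
    proof -
      have *: "(\<lambda>\<omega>. W (u n j) \<omega> - W 0 \<omega>) \<in> borel_measurable (F (t n i))" if "j \<le> n" for j
      proof (rule filtration_on_borel_measurable_mono[OF F _ past])
        show "u n j \<in> {0..a}" using u[OF that] by simp
        show "u n j \<le> t n i" using u[OF that] u(1)[of i n] \<open>i < n\<close> by (simp add: t_def)
      qed
      have "H i = (\<lambda>\<omega>. if 0 \<le> (W (u n (Suc i)) \<omega> - W 0 \<omega>) - (W (u n i) \<omega> - W 0 \<omega>) then 1 else - 1)"
        by (simp add: H_def fun_eq_iff)
      also have "\<dots> \<in> borel_measurable (F (t n i))"
        using that
        by (intro measurable_If borel_measurable_const
            borel_measurable_le[OF borel_measurable_const borel_measurable_diff[OF * *]]) auto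
      finally show ?thesis .
    qed
    show "\<bar>H i \<omega>\<bar> \<le> 1" for i \<omega> by (simp add: H_def)
    show "0 \<le> R" using \<open>0 \<le> e\<close> by (simp add: R_def)
    show "?G \<in> events" by fact
    have gain: "(\<Sum>i<k. \<bar>W (u n (Suc i)) \<omega> - W (u n i) \<omega>\<bar>) - real m
        \<le> (\<Sum>i<k. H i \<omega> * (M (t n (Suc i)) \<omega> - M (t n i) \<omega>))"
      and bound: "\<bar>M (t n k) \<omega>\<bar> \<le> real m" if "\<omega> \<in> ?G" "k \<le> n" for \<omega> k
    proof -
      have \<sigma>: "M (t n i) \<omega> = N (t n i) \<omega> - N 0 \<omega>" if "i \<le> n" for i
        using t(2)[OF that] \<open>\<omega> \<in> ?G\<close> by (simp add: M_def Q_def min_def)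
      show "\<bar>M (t n k) \<omega>\<bar> \<le> real m"
        using that \<sigma>[OF that(2)] by (simp add: B_def)
      have NV: "N (t n i) \<omega> = W (u n i) \<omega> - V (t n i) \<omega>" for i
        by (simp add: V_def t_def)
      have "(\<Sum>i<k. H i \<omega> * (M (t n (Suc i)) \<omega> - M (t n i) \<omega>))
          = (\<Sum>i<k. H i \<omega> * ((W (u n (Suc i)) \<omega> - V (t n (Suc i)) \<omega>) - (W (u n i) \<omega> - V (t n i) \<omega>)))"
        using that(2) by (intro sum.cong) (simp_all add: \<sigma> NV)
      moreover have "var n \<omega> \<le> real m"
        using that(1) by (simp add: B_def)
      ultimately show "(\<Sum>i<k. \<bar>W (u n (Suc i)) \<omega> - W (u n i) \<omega>\<bar>) - real m
        \<le> (\<Sum>i<k. H i \<omega> * (M (t n (Suc i)) \<omega> - M (t n i) \<omega>))"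
        using signed_increments_lower_bound[OF that(2), of "\<lambda>i. W (u n i) \<omega>" "\<lambda>i. V (t n i) \<omega>"]
        unfolding var_def H_def by linarith
    qed
    have pos: "0 \<le> (\<Sum>i<k. \<bar>W (u n (Suc i)) \<omega> - W (u n i) \<omega>\<bar>)" for k \<omega>
      by (simp add: sum_nonneg)
    show "- real m \<le> (\<Sum>i<k. H i \<omega> * (M (t n (Suc i)) \<omega> - M (t n i) \<omega>)) \<and> \<bar>M (t n k) \<omega>\<bar> \<le> real m"
      if "\<omega> \<in> ?G" "k \<le> n" for \<omega> k
      using gain[OF that] pos[of \<omega> k] bound[OF that] by linarith
    show "R \<le> (\<Sum>i<n. H i \<omega> * (M (t n (Suc i)) \<omega> - M (t n i) \<omega>))" if "\<omega> \<in> ?G" for \<omega>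
      using gain[OF that order_refl] that by (simp add: L_def)
  qed auto
  also have "t n n = 2 * a" using n(1) by (simp add: t_def u_def)
  finally have "R * prob ?G \<le> 2 * real m + e" by (simp add: e_def)
  moreover have "1/2 \<le> prob ?G"
    using prob_Int_ge[OF B_ev Q_ev, of m p] prob_Int_ge[of "B m \<inter> Q p" ?L] B_ev Q_ev L_ev m p n(2)
    by auto
  then have "R * (1/2) \<le> R * prob ?G"
    using \<open>0 \<le> e\<close> by (intro mult_left_mono) (auto simp: R_def)
  ultimately show False by (simp add: R_def)
qed

theorem proposition4p5:
  fixes P :: "'a measure" and W :: "real \<Rightarrow> 'a \<Rightarrow> real" and T \<tau> :: real
  assumes "prob_space P"
    and "0 < \<tau>" and "\<tau> \<le> T"
    and "standard_brownian_motion P T W"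
  shows "\<not> pettis_semimartingale P T (C_space (-\<tau>) 0) (window_process T \<tau> W)"
proof
  \<comment> \<open>Half the window, so that the path on \<open>[0,a]\<close> reappears with delay on all of
    \<open>[a, 2 * a] \<subseteq> [0,T]\<close>.\<close>
  define a where "a = \<tau> / 2"
  have a: "0 < a" "a \<le> \<tau>" "a \<le> T" "2 * a \<le> T"
    using assms(2,3) by (auto simp: a_def)
  define X where "X t \<omega> = delay_functional a (window_process T \<tau> W t \<omega>)" for t \<omega>
  assume "pettis_semimartingale P T (C_space (-\<tau>) 0) (window_process T \<tau> W)"
  moreover have "delay_functional a \<in> dual_space (C_space (-\<tau>) 0)"
    using a(1) by (intro delay_functional_in_dual_space) simp
  ultimately obtain F where F: "filtration_on P F" and X: "semimartingale P F T X"
    unfolding pettis_semimartingale_def X_def[abs_def] by blast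
  have cont: "continuous_on {0..T} (\<lambda>t. W t \<omega>)" if "\<omega> \<in> space P" for \<omega>
    using assms(4) that by (simp add: standard_brownian_motion_def)
  have XF: "X t \<in> borel_measurable (F t)" if "t \<in> {0..T}" for t
    using X that by (simp add: semimartingale_def adapted_def)
  have sp: "space (F t) = space P" for t
    using F by (simp add: filtration_on_def subalgebra_def)
  show False
  proof (rule semimartingale_not_anticipated_delayed_brownian[OF assms(1,4) a(1,4) F X])
    fix u assume u: "u \<in> {0..a}"
    show "(\<lambda>\<omega>. W u \<omega> - W 0 \<omega>) \<in> borel_measurable (F u)"
    proof (cases "u = 0")
      case False
      then have u0: "0 < u" "u \<le> a" using u by auto
      define Y where "Y n \<omega> = (X u \<omega> - X (u - u / real (Suc n)) \<omega>) / (u / real (Suc n))" for n \<omega>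
      show ?thesis
      proof (rule borel_measurable_LIMSEQ_real)
        show "(\<lambda>n. Y n \<omega>) \<longlonglongrightarrow> W u \<omega> - W 0 \<omega>" if "\<omega> \<in> space (F u)" for \<omega>
          unfolding Y_def X_def using that
          by (intro delay_functional_difference_quotient_tendsto[OF a(1-3) cont u0]) (simp add: sp)
        show "Y n \<in> borel_measurable (F u)" for n
        proof -
          have le: "u - u / real (Suc n) \<le> u" and "0 \<le> u - u / real (Suc n)"
            using u0 by (auto simp: field_simps)
          then have v: "u - u / real (Suc n) \<in> {0..T}" and uT: "u \<in> {0..T}"
            using u0 a(3) unfolding atLeastAtMost_iff by linarith+
          show ?thesis
            unfolding Y_def[abs_def]
            by (intro borel_measurable_divide borel_measurable_diff borel_measurable_const XF[OF uT]
                filtration_on_borel_measurable_mono[OF F le XF[OF v]])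
        qed
      qed
    qed simp
  next
    fix \<omega> assume "\<omega> \<in> space P"
    then show "\<exists>S. \<forall>s\<in>{a..T}. \<forall>t\<in>{a..T}.
        \<bar>(X t \<omega> - W (t - a) \<omega>) - (X s \<omega> - W (s - a) \<omega>)\<bar> \<le> S * \<bar>t - s\<bar>"
      using delay_functional_minus_delay_lipschitz[where W = W and \<omega> = \<omega>, OF a(1-3) cont]
      by (simp add: X_def)
  qed
qed

end
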